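(* Let $H_n$ be the Hermite polynomials, and put $\sigma=\sqrt{\xi^2-2n}$. As $n\to\infty$: (i) In the region $\xi<-\sqrt{2n}$, $$H_n(\xi)\sim\Lambda_1(\xi)\equiv(-1)^n\exp\left[\Phi_1(\xi)\right]U_1(\xi),$$ where $$\Phi_1(\xi)=n\ln(\sigma-\xi)+\frac{\xi^2+\sigma\xi-n}{2},\qquad U_1(\xi)=\sqrt{\frac12\left(1-\frac{\xi}{\sigma}\right)}.$$ (ii) In the region $\xi>\sqrt{2n}$, $$H_n(\xi)\sim\Lambda_2(\xi)\equiv\exp\left[\Phi_2(\xi)\right]U_2(\xi),$$ where $$\Phi_2(\xi)=n\ln(\sigma+\xi)+\frac{\xi^2-\sigma\xi-n}{2},\qquad U_2(\xi)=\sqrt{\frac12\left(1+\frac{\xi}{\sigma}\right)}.$$ Moreover, $\Lambda_1(-\xi)=(-1)^n\Lambda_2(\xi)$.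
   Context: The Hermite polynomials are $H_n(x)=n!\sum_{k=0}^{\lfloor n/2\rfloor}\frac{(-1)^k}{k!(n-2k)!}(2x)^{n-2k}$, $n=0,1,2,\ldots$.
   Formalization: The asymptotics are proved for all ξ=ξ_n in the regions with n^{1/6}(|ξ_n|−√(2n))→∞; without this they fail, since Λ₁ and Λ₂ blow up as ξ→∓√(2n) (σ→0) while H_n(ξ) stays finite. *)

theory Defs
  imports Complex_Main "HOL-Library.Landau_Symbols"
begin

definition Hermite :: "nat \<Rightarrow> real \<Rightarrow> real" where
  "Hermite n x =
     fact n * (\<Sum>k = 0..n div 2. (-1) ^ k / (fact k * fact (n - 2 * k)) * (2 * x) ^ (n - 2 * k))"

definition sigma :: "nat \<Rightarrow> real \<Rightarrow> real" where
  "sigma n \<xi> = sqrt (\<xi>\<^sup>2 - 2 * real n)"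

definition Phi1 :: "nat \<Rightarrow> real \<Rightarrow> real" where
  "Phi1 n \<xi> = real n * ln (sigma n \<xi> - \<xi>) + (\<xi>\<^sup>2 + sigma n \<xi> * \<xi> - real n) / 2"

definition U1 :: "nat \<Rightarrow> real \<Rightarrow> real" where
  "U1 n \<xi> = sqrt (1 / 2 * (1 - \<xi> / sigma n \<xi>))"

definition Lambda1 :: "nat \<Rightarrow> real \<Rightarrow> real" where
  "Lambda1 n \<xi> = (-1) ^ n * exp (Phi1 n \<xi>) * U1 n \<xi>"

definition Phi2 :: "nat \<Rightarrow> real \<Rightarrow> real" where
  "Phi2 n \<xi> = real n * ln (sigma n \<xi> + \<xi>) + (\<xi>\<^sup>2 - sigma n \<xi> * \<xi> - real n) / 2"

definition U2 :: "nat \<Rightarrow> real \<Rightarrow> real" where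
  "U2 n \<xi> = sqrt (1 / 2 * (1 + \<xi> / sigma n \<xi>))"

definition Lambda2 :: "nat \<Rightarrow> real \<Rightarrow> real" where
  "Lambda2 n \<xi> = exp (Phi2 n \<xi>) * U2 n \<xi>"

(* For fixed xi the condition xi > sqrt(2n) fails for large n, so the asymptotics in
   the outer regions concern points xi n that move with n. The points must stay outside the
   Airy transition layers, of width n^(-1/6), around the turning points -sqrt(2n) and sqrt(2n):
   at distance c * n^(-1/6), c > 0, the quotient of Hermite n by Lambda1 or Lambda2 has a limit
   that is not 1. Leaving the layers is the only restriction imposed; in particular
   xi n = x * sqrt (2 * n) with fixed x > 1 is allowed, and quantifying over all such
   sequences gives uniformity, e.g. in xi >= (1 + d) * sqrt (2 * n) for each fixed d > 0. *)

definition in_left_region :: "(nat \<Rightarrow> real) \<Rightarrow> bool" where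
  "in_left_region \<xi> \<longleftrightarrow>
     (\<forall>\<^sub>F n in sequentially. \<xi> n < - sqrt (2 * real n)) \<and>
     filterlim (\<lambda>n. real n powr (1 / 6) * (- sqrt (2 * real n) - \<xi> n)) at_top sequentially"

definition in_right_region :: "(nat \<Rightarrow> real) \<Rightarrow> bool" where
  "in_right_region \<xi> \<longleftrightarrow>
     (\<forall>\<^sub>F n in sequentially. \<xi> n > sqrt (2 * real n)) \<and>
     filterlim (\<lambda>n. real n powr (1 / 6) * (\<xi> n - sqrt (2 * real n))) at_top sequentially"

end

theory Submission
  imports Defs "HOL-Real_Asymp.Real_Asymp"
begin

text \<open>
  Write \<open>s = sigma n x\<close>. On \<open>x > sqrt (2 n)\<close> the logarithmic derivative \<open>h = H_n' / H_n\<close>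
  solves the Riccati equation \<open>h' = 2 x h - 2 n - h\<^sup>2\<close>, and the three-term recurrence gives
  \<open>0 \<le> h \<le> x - s\<close>. The logarithmic derivative \<open>lambda = (x - s) (1 - 1 / (2 s\<^sup>2))\<close> of \<open>Lambda2\<close>
  solves the same equation up to the nonnegative residual \<open>(x - s) (5 x + s) / (4 s^4)\<close>.
  The linearised equation repels forward in \<open>x\<close> at rate about \<open>2 s\<close>, and both functions vanish at
  infinity, so comparison from infinity yields \<open>lambda \<le> h \<le> lambda + x (x - s) / s^5\<close> as soon as
  \<open>2 x\<^sup>2 \<le> s^6\<close>. Since \<open>ln (H_n / Lambda2)\<close> tends to 0 as \<open>x\<close> tends to infinity with \<open>n\<close> fixed,
  integration gives \<open>- x / (2 s\<^sup>3) \<le> ln (H_n / Lambda2) \<le> 0\<close>. Finally, with \<open>d = x - sqrt (2 n)\<close>,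
  \<open>(x / s\<^sup>3)\<^sup>2 \<le> 1 / (d\<^sup>3 sqrt n) = 1 / (n powr (1/6) * d)\<^sup>3\<close>, which tends to 0 exactly when the points
  leave the Airy layer. The left region follows by parity.
\<close>

section \<open>Hermite polynomials: recurrence, derivative and parity\<close>

definition hermite_term :: "real \<Rightarrow> nat \<Rightarrow> nat \<Rightarrow> real" where
  "hermite_term x n k =
     (if 2 * k \<le> n then (-1) ^ k / (fact k * fact (n - 2 * k)) * (2 * x) ^ (n - 2 * k) else 0)"

text \<open>The zero padding in \<open>hermite_term\<close> makes the upper limit of summation
  arbitrary, so sums belonging to consecutive degrees can be compared term by term.\<close>

lemma Hermite_eq_sum_atMost:
  assumes "n div 2 \<le> M"
  shows "Hermite n x = fact n * (\<Sum>k\<le>M. hermite_term x n k)"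
proof -
  have "(\<Sum>k\<le>M. hermite_term x n k) = (\<Sum>k = 0..n div 2. hermite_term x n k)"
    using assms by (intro sum.mono_neutral_right) (auto simp: hermite_term_def)
  also have "\<dots> = (\<Sum>k = 0..n div 2. (-1) ^ k / (fact k * fact (n - 2 * k)) * (2 * x) ^ (n - 2 * k))"
    by (intro sum.cong) (auto simp: hermite_term_def)
  finally show ?thesis by (simp add: Hermite_def)
qed

text \<open>The weight cancels the top factor of \<open>fact (n + 1 - 2 * k)\<close>. At
  \<open>2 * k = n + 1\<close> it vanishes, which matches the padding on the right.\<close>

lemma hermite_term_lower_degree:
  "(real n + 1 - 2 * real k) * hermite_term x (Suc n) k = 2 * x * hermite_term x n k"
proof (cases "2 * k \<le> n")
  case True
  then have "Suc n - 2 * k = Suc (n - 2 * k)" "real n + 1 - 2 * real k = real (Suc (n - 2 * k))"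
    by (auto simp: of_nat_diff)
  with True show ?thesis
    by (simp add: hermite_term_def del: of_nat_Suc)
next
  case False
  then consider "2 * k = Suc n" | "2 * k > Suc n" by linarith
  then show ?thesis
  proof cases
    case 1
    then have "real n + 1 - 2 * real k = 0" by linarith
    with 1 show ?thesis by (simp add: hermite_term_def)
  qed (simp add: hermite_term_def)
qed

lemma hermite_term_shift:
  "real (Suc k) * hermite_term x (Suc (Suc n)) (Suc k) = - hermite_term x n k"
  by (auto simp: hermite_term_def divide_simps)

lemma Hermite_0 [simp]: "Hermite 0 x = 1"
  by (simp add: Hermite_def)

lemma Hermite_1: "Hermite (Suc 0) x = 2 * x"
  by (simp add: Hermite_def)

lemma Hermite_rec:
  "Hermite (Suc (Suc n)) x = 2 * x * Hermite (Suc n) x - 2 * real (Suc n) * Hermite n x"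
proof -
  let ?T = "hermite_term x"
  define M where "M = Suc n"
  \<comment> \<open>Split the weight as (n + 2 - 2k) + 2k: the first part lowers the degree to n +
    1, the second shifts k by one and leads to degree n.\<close>
  have "(real n + 2) * (\<Sum>k\<le>M. ?T (Suc (Suc n)) k)
      = (\<Sum>k\<le>M. (real (Suc n) + 1 - 2 * real k) * ?T (Suc (Suc n)) k)
        + 2 * (\<Sum>k\<le>M. real k * ?T (Suc (Suc n)) k)"
    by (simp add: sum_distrib_left algebra_simps flip: sum.distrib)
  also have "(\<Sum>k\<le>M. (real (Suc n) + 1 - 2 * real k) * ?T (Suc (Suc n)) k)
      = 2 * x * (\<Sum>k\<le>M. ?T (Suc n) k)"
    by (simp only: hermite_term_lower_degree sum_distrib_left)
  also have "(\<Sum>k\<le>M. real k * ?T (Suc (Suc n)) k) = - (\<Sum>k\<le>n. ?T n k)"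
    unfolding M_def sum.atMost_Suc_shift
    by (simp only: hermite_term_shift sum_negf of_nat_0 mult_zero_left add_0)
  finally have *: "(real n + 2) * (\<Sum>k\<le>M. ?T (Suc (Suc n)) k)
      = 2 * x * (\<Sum>k\<le>M. ?T (Suc n) k) - 2 * (\<Sum>k\<le>n. ?T n k)" by simp
  have "Hermite (Suc (Suc n)) x = fact (Suc n) * ((real n + 2) * (\<Sum>k\<le>M. ?T (Suc (Suc n)) k))"
    by (subst Hermite_eq_sum_atMost[of _ M]) (auto simp: M_def algebra_simps)
  also have "\<dots> = 2 * x * (fact (Suc n) * (\<Sum>k\<le>M. ?T (Suc n) k))
      - 2 * real (Suc n) * (fact n * (\<Sum>k\<le>n. ?T n k))"
    unfolding * by (simp add: algebra_simps)
  also have "fact (Suc n) * (\<Sum>k\<le>M. ?T (Suc n) k) = Hermite (Suc n) x"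
    by (rule Hermite_eq_sum_atMost[symmetric]) (simp add: M_def)
  also have "fact n * (\<Sum>k\<le>n. ?T n k) = Hermite n x"
    by (rule Hermite_eq_sum_atMost[symmetric]) simp
  finally show ?thesis .
qed

text \<open>This form includes degree 0: there \<open>n - 1\<close> truncates to 0, but its
  coefficient vanishes.\<close>

lemma Hermite_Suc:
  "Hermite (Suc n) x = 2 * x * Hermite n x - 2 * real n * Hermite (n - 1) x"
  by (cases n) (simp_all add: Hermite_rec Hermite_1)

lemma has_real_derivative_Hermite:
  "(Hermite n has_real_derivative 2 * real n * Hermite (n - 1) x) (at x)"
proof (induction n rule: less_induct)
  case (less n)
  show ?case
  proof (cases n)
    case 0
    then have "Hermite n = (\<lambda>_. 1)" by auto
    with 0 show ?thesis by simp
  next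
    case (Suc m)
    have eq: "Hermite n = (\<lambda>x. 2 * x * Hermite m x - 2 * real m * Hermite (m - 1) x)"
      using Suc Hermite_Suc by auto
    have 1: "(Hermite m has_real_derivative 2 * real m * Hermite (m - 1) x) (at x)"
      using less Suc by simp
    \<comment> \<open>The recurrence removes the index m - 2, leaving only indices m and m - 1.
      Keeping the factor m inside makes m = 0 trivial.\<close>
    have 2: "((\<lambda>x. real m * Hermite (m - 1) x) has_real_derivative
        real m * (2 * x * Hermite (m - 1) x - Hermite m x)) (at x)"
    proof (cases m)
      case (Suc l)
      have "(Hermite l has_real_derivative 2 * real l * Hermite (l - 1) x) (at x)"
        using less Suc \<open>n = Suc m\<close> by simp
      from DERIV_cmult[OF this, of "real m"] show ?thesis
        using Suc Hermite_Suc[of l x] by simp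
    qed simp
    show ?thesis
      unfolding eq
      by (rule DERIV_cong[OF DERIV_diff[OF DERIV_mult[OF DERIV_cmult[OF DERIV_ident, of 2] 1]
            DERIV_cmult[OF 2, of 2, folded mult.assoc]]])
         (simp add: Suc algebra_simps)
  qed
qed

lemma Hermite_minus: "Hermite n (- x) = (-1) ^ n * Hermite n x"
proof (induction n rule: less_induct)
  case (less n)
  show ?case
  proof (cases n)
    case (Suc m)
    show ?thesis
    proof (cases m)
      case (Suc l)
      then show ?thesis using less \<open>n = Suc m\<close> by (simp add: Hermite_rec algebra_simps)
    qed (simp add: Suc Hermite_1)
  qed simp
qed

section \<open>The square root \<open>sigma\<close> and positivity in the outer region\<close>

lemma sigma_pos:
  assumes "2 * real n < x\<^sup>2"
  shows "sigma n x > 0"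
  using assms by (simp add: sigma_def)

lemma sigma_square:
  assumes "2 * real n < x\<^sup>2"
  shows "(sigma n x)\<^sup>2 = x\<^sup>2 - 2 * real n"
  using assms by (simp add: sigma_def)

lemma sigma_le:
  assumes "x > 0"
  shows "sigma n x \<le> x"
  using assms by (auto simp: sigma_def intro!: real_le_lsqrt)

lemma sigma_decreasing:
  assumes "m \<le> n"
  shows "sigma n x \<le> sigma m x"
  using assms by (auto simp: sigma_def)

lemma has_real_derivative_sigma [derivative_intros]:
  assumes "2 * real n < x\<^sup>2"
  shows "(sigma n has_real_derivative x / sigma n x) (at x)"
  unfolding sigma_def[abs_def] using assms
  by (auto intro!: derivative_eq_intros simp: field_simps)

text \<open>Write s_n for \<open>sigma n x\<close>. The two claims support each other in the
  induction: the ratio bound at n turns the recurrence into H_{n+1} >= (x + s_n) H_n >= (x +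
  s_{n+1}) H_n > 0. Multiplying by x - s_{n+1} gives the next ratio bound, as (x - s_{n+1}) (x +
  s_{n+1}) = 2 (n + 1).\<close>

lemma Hermite_pos_and_ratio:
  assumes "x > 0" "2 * real n < x\<^sup>2"
  shows "Hermite n x > 0 \<and> 2 * real n * Hermite (n - 1) x \<le> (x - sigma n x) * Hermite n x"
  using assms
proof (induction n)
  case 0
  then show ?case by (simp add: sigma_def)
next
  case (Suc n)
  then have n: "2 * real n < x\<^sup>2" by simp
  with Suc have pos: "Hermite n x > 0"
    and ratio: "2 * real n * Hermite (n - 1) x \<le> (x - sigma n x) * Hermite n x" by auto
  have "(x + sigma (Suc n) x) * Hermite n x \<le> (x + sigma n x) * Hermite n x"
    using pos sigma_decreasing[of n "Suc n" x] by (intro mult_right_mono) auto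
  also have "\<dots> \<le> Hermite (Suc n) x"
    using ratio by (simp add: Hermite_Suc algebra_simps)
  finally have *: "(x + sigma (Suc n) x) * Hermite n x \<le> Hermite (Suc n) x" .
  moreover have "(x + sigma (Suc n) x) * Hermite n x > 0"
    using Suc.prems pos sigma_pos[of "Suc n" x] by auto
  moreover have "(x - sigma (Suc n) x) * ((x + sigma (Suc n) x) * Hermite n x)
      = 2 * real (Suc n) * Hermite n x"
  proof -
    have "(x - sigma (Suc n) x) * (x + sigma (Suc n) x) = 2 * real (Suc n)"
      using sigma_square[of "Suc n" x] Suc.prems by (simp add: algebra_simps power2_eq_square)
    then show ?thesis by (simp only: flip: mult.assoc)
  qed
  moreover have "(x - sigma (Suc n) x) * ((x + sigma (Suc n) x) * Hermite n x)
      \<le> (x - sigma (Suc n) x) * Hermite (Suc n) x"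
    using * sigma_le[of x "Suc n"] Suc.prems by (intro mult_left_mono) auto
  ultimately show ?case by (metis diff_Suc_1 less_le_trans)
qed

section \<open>Riccati equations for the exact and approximate logarithmic derivatives\<close>

definition hermite_logderiv :: "nat \<Rightarrow> real \<Rightarrow> real" where
  "hermite_logderiv n x = 2 * real n * Hermite (n - 1) x / Hermite n x"

lemma hermite_logderiv_le:
  assumes "x > 0" "2 * real n < x\<^sup>2"
  shows "hermite_logderiv n x \<le> x - sigma n x"
  using Hermite_pos_and_ratio[OF assms] by (simp add: hermite_logderiv_def divide_simps)

lemma hermite_logderiv_nonneg:
  assumes "x > 0" "2 * real n < x\<^sup>2"
  shows "hermite_logderiv n x \<ge> 0"
proof -
  have "2 * real (n - 1) < x\<^sup>2" using assms by (smt (verit) diff_le_self of_nat_le_iff)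
  then show ?thesis
    using Hermite_pos_and_ratio[of x n] Hermite_pos_and_ratio[of x "n - 1"] assms
    by (simp add: hermite_logderiv_def)
qed

text \<open>This is Hermite's equation y'' = 2 x y' - 2 n y divided by y. Fact \<open>2\<close> in
  the proof is that equation, with y' written as 2 n H_{n-1}.\<close>

lemma hermite_logderiv_riccati:
  assumes "x > 0" "2 * real n < x\<^sup>2"
  shows "(hermite_logderiv n has_real_derivative
    2 * x * hermite_logderiv n x - 2 * real n - (hermite_logderiv n x)\<^sup>2) (at x)"
proof -
  have nz: "Hermite n x \<noteq> 0" using Hermite_pos_and_ratio[OF assms] by simp
  have 2: "((\<lambda>x. 2 * real n * Hermite (n - 1) x) has_real_derivative
      2 * real n * (2 * x * Hermite (n - 1) x - Hermite n x)) (at x)"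
  proof (cases n)
    case (Suc l)
    from DERIV_cmult[OF has_real_derivative_Hermite[of l x], of "2 * real n"] show ?thesis
      using Suc Hermite_Suc[of l x] by simp
  qed simp
  show ?thesis
    unfolding hermite_logderiv_def[abs_def]
    by (rule DERIV_cong[OF DERIV_divide[OF 2 has_real_derivative_Hermite nz]])
       (use nz in \<open>simp add: field_simps power2_eq_square\<close>)
qed

text \<open>The term x - s is the derivative of \<open>Phi2\<close>; the correction -(x - s) / (2
  s^2) comes from the amplitude \<open>U2\<close>.\<close>

definition lambda :: "nat \<Rightarrow> real \<Rightarrow> real" where
  "lambda n x = (x - sigma n x) * (1 - 1 / (2 * (sigma n x)\<^sup>2))"

text \<open>A barrier for the error of \<open>lambda\<close>: the Riccati residual is at most 3/2 s
  times it, while the linearised equation supplies -2 s times it, leaving s/2 times it to absorb the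
  quadratic term.\<close>

definition excess :: "nat \<Rightarrow> real \<Rightarrow> real" where
  "excess n x = (x - sigma n x) * x / (sigma n x) ^ 5"

lemma lambda_riccati:
  assumes "x > 0" "2 * real n < x\<^sup>2"
  shows "(lambda n has_real_derivative
    2 * x * lambda n x - 2 * real n - (lambda n x)\<^sup>2
      + (x - sigma n x) * (5 * x + sigma n x) / (4 * sigma n x ^ 4)) (at x)"
proof -
  define s where "s = sigma n x"
  \<comment> \<open>Eliminating n through s makes the claim an identity of rational functions in x
    and s.\<close>
  have s: "s > 0" "2 * real n = x\<^sup>2 - s\<^sup>2"
    using sigma_pos sigma_square assms by (auto simp: s_def)
  have "(lambda n has_real_derivative
      (1 - x / s) * (1 - 1 / (2 * s\<^sup>2)) + (x - s) * (x / s ^ 4)) (at x)"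
    unfolding lambda_def[abs_def]
    using assms s(1)
    by (auto intro!: derivative_eq_intros simp: s_def[symmetric] field_simps eval_nat_numeral)
  moreover have "(1 - x / s) * (1 - 1 / (2 * s\<^sup>2)) + (x - s) * (x / s ^ 4)
     = 2 * x * lambda n x - 2 * real n - (lambda n x)\<^sup>2
      + (x - s) * (5 * x + s) / (4 * s ^ 4)"
    unfolding lambda_def s_def[symmetric] s(2) using s(1)
    by (simp add: field_simps eval_nat_numeral)
  ultimately show ?thesis by (simp add: s_def)
qed

lemma has_real_derivative_excess:
  assumes "x > 0" "2 * real n < x\<^sup>2"
  obtains D where "(excess n has_real_derivative D) (at x)" "D \<le> 0"
proof -
  define s where "s = sigma n x"
  have s: "s > 0" "s \<le> x"
    using sigma_pos sigma_le assms by (auto simp: s_def)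
  let ?D = "- ((x - s) * (x - s) / s ^ 6 + 5 * (x - s) * x\<^sup>2 / s ^ 7)"
  have "(excess n has_real_derivative ?D) (at x)"
    unfolding excess_def[abs_def]
    using assms s(1)
    by (auto intro!: derivative_eq_intros simp: s_def[symmetric] field_simps eval_nat_numeral)
  moreover have "?D \<le> 0"
    unfolding neg_le_0_iff_le using s assms
    by (intro add_nonneg_nonneg divide_nonneg_nonneg mult_nonneg_nonneg) auto
  ultimately show ?thesis using that by blast
qed

section \<open>Comparison from infinity\<close>

lemma minimum_principle_at_top:
  fixes f :: "real \<Rightarrow> real"
  assumes lim: "(f \<longlongrightarrow> 0) at_top"
    and der: "\<And>x. x \<ge> a \<Longrightarrow> (f has_real_derivative f' x) (at x)"
    and neg: "\<And>x. x \<ge> a \<Longrightarrow> f x < 0 \<Longrightarrow> f' x < 0"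
    and "a \<le> b"
  shows "f b \<ge> 0"
proof (rule ccontr)
  assume b: "\<not> f b \<ge> 0"
  \<comment> \<open>Since f tends to 0, it rises above the negative value f b at some c >= b, so a
    minimum over [b, c] is negative and is not attained at c.\<close>
  then have "eventually (\<lambda>x. f x > f b) at_top"
    using lim by (intro order_tendstoD) auto
  from eventually_happens'[OF _ eventually_conj[OF this eventually_ge_at_top[of b]]]
  obtain c where c: "f c > f b" "c \<ge> b" by auto
  have "continuous_on {b..c} f"
    using der \<open>a \<le> b\<close> by (intro DERIV_continuous_on[where D = f']) (auto intro: has_field_derivative_at_within)
  then obtain m where m: "m \<in> {b..c}" "\<And>x. x \<in> {b..c} \<Longrightarrow> f m \<le> f x"
    using continuous_attains_inf[of "{b..c}" f] c by auto
  have "f m < 0" "m \<noteq> c" using m(2)[of b] b c by auto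
  then have "f' m < 0" "m < c" using neg[of m] m \<open>a \<le> b\<close> by auto
  \<comment> \<open>At this minimum the derivative is negative, so f drops further just to its
    right, still inside [b, c].\<close>
  then obtain d where d: "d > 0" "\<And>h. 0 < h \<Longrightarrow> h < d \<Longrightarrow> f (m + h) < f m"
    using DERIV_neg_dec_right[OF der[of m]] m \<open>a \<le> b\<close> by auto
  define h where "h = min (d / 2) (c - m)"
  have "0 < h" "h < d" "m + h \<in> {b..c}" using d(1) m \<open>m < c\<close> by (auto simp: h_def)
  then show False using d(2)[of h] m(2)[of "m + h"] by auto
qed

lemma nonpos_of_increasing_to_0:
  fixes f :: "real \<Rightarrow> real"
  assumes lim: "(f \<longlongrightarrow> 0) at_top"
    and der: "\<And>x. x \<ge> a \<Longrightarrow> (f has_real_derivative f' x) (at x)"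
    and nonneg: "\<And>x. x \<ge> a \<Longrightarrow> f' x \<ge> 0"
  shows "f a \<le> 0"
proof (rule tendsto_lowerbound[OF lim])
  show "eventually (\<lambda>x. f a \<le> f x) at_top"
    using eventually_ge_at_top[of a]
  proof eventually_elim
    case (elim x)
    then show ?case
      by (rule DERIV_nonneg_imp_nondecreasing) (metis der nonneg)
  qed
qed simp

section \<open>Limits as x tends to infinity with n fixed\<close>

lemma diff_sigma_tendsto:
  assumes "n > 0"
  shows "((\<lambda>x. x - sigma n x) \<longlongrightarrow> 0) at_top"
  using assms unfolding sigma_def by real_asymp

lemma lambda_tendsto:
  assumes "n > 0"
  shows "(lambda n \<longlongrightarrow> 0) at_top"
  using assms unfolding sigma_def lambda_def[abs_def] by real_asymp

lemma excess_tendsto: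
  assumes "n > 0"
  shows "(excess n \<longlongrightarrow> 0) at_top"
  using assms unfolding sigma_def excess_def[abs_def] by real_asymp

lemma eventually_outer_region: "eventually (\<lambda>x. x > 0 \<and> 2 * real n < x\<^sup>2) at_top"
proof -
  have "eventually (\<lambda>x. x > 0) (at_top :: real filter)" by real_asymp
  moreover have "eventually (\<lambda>x. 2 * real n < x\<^sup>2) at_top" by real_asymp
  ultimately show ?thesis by eventually_elim simp
qed

lemma hermite_logderiv_tendsto: "(hermite_logderiv n \<longlongrightarrow> 0) at_top"
proof (cases "n = 0")
  case True
  then have "hermite_logderiv n = (\<lambda>_. 0)" by (auto simp: hermite_logderiv_def)
  then show ?thesis by simp
next
  case False
  show ?thesis
  proof (rule tendsto_sandwich)
    show "eventually (\<lambda>x. 0 \<le> hermite_logderiv n x) at_top"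
      using eventually_outer_region[of n]
      by eventually_elim (auto intro: hermite_logderiv_nonneg)
    show "eventually (\<lambda>x. hermite_logderiv n x \<le> x - sigma n x) at_top"
      using eventually_outer_region[of n]
      by eventually_elim (auto intro: hermite_logderiv_le)
    show "((\<lambda>x. x - sigma n x) \<longlongrightarrow> 0) at_top"
      using False diff_sigma_tendsto by simp
  qed simp
qed

text \<open>By the recurrence, raising n by one multiplies the quotient by 1 - h / (2 x), where h =
  \<open>hermite_logderiv n x\<close> tends to 0.\<close>

lemma Hermite_leading_term: "((\<lambda>x. Hermite n x / (2 * x) ^ n) \<longlongrightarrow> 1) at_top"
proof (induction n)
  case (Suc n)
  have "((\<lambda>x. hermite_logderiv n x * (1 / (2 * x))) \<longlongrightarrow> 0 * 0) at_top"
    by (intro tendsto_mult hermite_logderiv_tendsto) real_asymp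
  then have "((\<lambda>x. Hermite n x / (2 * x) ^ n * (1 - hermite_logderiv n x * (1 / (2 * x)))) \<longlongrightarrow> 1 * (1 - 0)) at_top"
    by (intro tendsto_mult Suc.IH tendsto_diff tendsto_const) simp
  moreover have "eventually (\<lambda>x. Hermite n x / (2 * x) ^ n * (1 - hermite_logderiv n x * (1 / (2 * x)))
      = Hermite (Suc n) x / (2 * x) ^ Suc n) at_top"
    using eventually_outer_region[of n]
  proof eventually_elim
    case (elim x)
    then have "Hermite n x \<noteq> 0" using Hermite_pos_and_ratio[of x n] by simp
    with elim show ?case
      by (simp add: hermite_logderiv_def Hermite_Suc) (simp add: field_simps)
  qed
  ultimately have "((\<lambda>x. Hermite (Suc n) x / (2 * x) ^ Suc n) \<longlongrightarrow> 1 * (1 - 0)) at_top"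
    by (rule Lim_transform_eventually)
  then show ?case by simp
qed simp

section \<open>The logarithm of \<open>Lambda2\<close> and its match with H_n at infinity\<close>

definition ln_Lambda2 :: "nat \<Rightarrow> real \<Rightarrow> real" where
  "ln_Lambda2 n x = Phi2 n x + 1 / 2 * ln (1 / 2 * (1 + x / sigma n x))"

lemma Lambda2_eq_exp:
  assumes "x > 0" "2 * real n < x\<^sup>2"
  shows "Lambda2 n x = exp (ln_Lambda2 n x)"
proof -
  have "1 / 2 * (1 + x / sigma n x) > 0"
    using assms sigma_pos[of n x] by (simp add: add_pos_pos)
  then have "U2 n x = exp (1 / 2 * ln (1 / 2 * (1 + x / sigma n x)))"
    unfolding U2_def by (subst powr_half_sqrt[symmetric]) (auto simp: powr_def)
  then show ?thesis by (simp add: Lambda2_def ln_Lambda2_def exp_add)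
qed

lemma has_real_derivative_ln_Lambda2:
  assumes "x > 0" "2 * real n < x\<^sup>2"
  shows "(ln_Lambda2 n has_real_derivative lambda n x) (at x)"
proof -
  define s where "s = sigma n x"
  have s: "s > 0" "2 * real n = x\<^sup>2 - s\<^sup>2"
    using sigma_pos sigma_square assms by (auto simp: s_def)
  have pos: "s + x > 0" "1 / 2 * (1 + x / s) > 0" using s(1) assms by (auto simp: add_pos_pos)
  let ?D1 = "real n * ((x / s + 1) / (s + x)) + (2 * x - (x / s * x + s)) / 2"
  let ?D2 = "1 / 2 * (inverse (1 / 2 * (1 + x / s)) * (1 / 2 * ((s - x * (x / s)) / s\<^sup>2)))"
  have "(Phi2 n has_real_derivative ?D1) (at x)"
    unfolding Phi2_def[abs_def] using assms s(1) pos
    by (auto intro!: derivative_eq_intros simp: s_def[symmetric]) (simp add: field_simps)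
  moreover have "((\<lambda>x. 1 / 2 * ln (1 / 2 * (1 + x / sigma n x))) has_real_derivative ?D2) (at x)"
  proof -
    have "((\<lambda>x. 1 / 2 * (1 + x / sigma n x)) has_real_derivative
        1 / 2 * ((s - x * (x / s)) / s\<^sup>2)) (at x)"
      using assms s(1)
      by (auto intro!: derivative_eq_intros simp: s_def[symmetric] power2_eq_square)
         (simp add: field_simps)
    from DERIV_cmult[OF DERIV_chain2[where f = ln, OF DERIV_ln this], of "1 / 2"] pos(2)
    show ?thesis by (simp only: s_def)
  qed
  ultimately have "(ln_Lambda2 n has_real_derivative ?D1 + ?D2) (at x)"
    unfolding ln_Lambda2_def[abs_def] by (rule DERIV_add)
  moreover have "?D1 = x - s"
  proof -
    have "x / s + 1 = (s + x) / s" using s(1) by (simp add: field_simps)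
    then have "(x / s + 1) / (s + x) = 1 / s" using s(1) pos by simp
    then have "?D1 = (2 * real n) / (2 * s) + (2 * x - (x / s * x + s)) / 2" by simp
    also have "\<dots> = x - s" unfolding s(2) using s(1) by (simp add: field_simps power2_eq_square)
    finally show ?thesis .
  qed
  moreover have "?D2 = - (x - s) / (2 * s\<^sup>2)"
  proof -
    \<comment> \<open>From s^2 - x^2 = (s - x) (s + x); the factor 1 + x/s then cancels against the
      argument of the logarithm.\<close>
    have eq: "(s - x * (x / s)) / s\<^sup>2 = (s - x) / s\<^sup>2 * (1 + x / s)"
      using s(1) by (simp add: field_simps)
    have cancel: "1 / 2 * (inverse (1 / 2 * k) * (1 / 2 * (t * k))) = t / 2" if "k > 0" for k t :: real
      using that by (simp add: field_simps)
    have "?D2 = (s - x) / s\<^sup>2 / 2"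
      unfolding eq by (rule cancel) (use pos(2) in simp)
    then show ?thesis by simp
  qed
  ultimately have "(ln_Lambda2 n has_real_derivative (x - s) + - (x - s) / (2 * s\<^sup>2)) (at x)"
    by (simp only:)
  then show ?thesis
    by (rule DERIV_cong) (simp add: lambda_def s_def[symmetric] right_diff_distrib diff_divide_distrib)
qed

text \<open>This fixes the constant of integration. Here x (x - s) tends to n, so the algebraic part
  of \<open>Phi2\<close> tends to 0, and \<open>U2\<close> tends to 1.\<close>

lemma ln_Lambda2_asymp:
  assumes "n > 0"
  shows "((\<lambda>x. ln_Lambda2 n x - real n * ln (2 * x)) \<longlongrightarrow> 0) at_top"
  using assms unfolding sigma_def ln_Lambda2_def Phi2_def by real_asymp

lemma ln_quotient_tendsto:
  assumes "n > 0"
  shows "((\<lambda>x. ln (Hermite n x) - ln_Lambda2 n x) \<longlongrightarrow> 0) at_top"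
proof -
  have "((\<lambda>x. ln (Hermite n x / (2 * x) ^ n)) \<longlongrightarrow> ln 1) at_top"
    by (intro tendsto_ln Hermite_leading_term) simp
  then have "((\<lambda>x. ln (Hermite n x / (2 * x) ^ n) - (ln_Lambda2 n x - real n * ln (2 * x))) \<longlongrightarrow> ln 1 - 0) at_top"
    by (intro tendsto_diff ln_Lambda2_asymp assms)
  then have "((\<lambda>x. ln (Hermite n x / (2 * x) ^ n) - (ln_Lambda2 n x - real n * ln (2 * x))) \<longlongrightarrow> 0) at_top"
    by simp
  moreover have "eventually (\<lambda>x. ln (Hermite n x / (2 * x) ^ n) - (ln_Lambda2 n x - real n * ln (2 * x))
      = ln (Hermite n x) - ln_Lambda2 n x) at_top"
    using eventually_outer_region[of n]
  proof eventually_elim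
    case (elim x)
    then have "Hermite n x > 0" "(2 * x) ^ n > 0" "ln ((2 * x) ^ n) = real n * ln (2 * x)"
      using Hermite_pos_and_ratio[of x n] ln_realpow[of "2 * x" n] by auto
    then show ?case using elim by (simp add: ln_div del: power_mult_distrib)
  qed
  ultimately show ?thesis by (rule Lim_transform_eventually)
qed

section \<open>Two-sided comparison of the logarithmic derivatives, and its integration\<close>

lemma outer_region_mono:
  fixes a x :: real
  assumes "a > 0" "2 * real n < a\<^sup>2" "a \<le> x"
  shows "x > 0" "2 * real n < x\<^sup>2"
  using assms power_mono[of a x 2] by linarith+

text \<open>The difference f = h - lambda satisfies f' = (2 x - h - lambda) f - R with R >= 0. Both
  h and lambda are at most x - s, so the coefficient is at least 2 s, and f < 0 forces f' <
  0.\<close>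

lemma lambda_le_hermite_logderiv:
  assumes "n > 0" "a > 0" "2 * real n < a\<^sup>2"
  shows "lambda n a \<le> hermite_logderiv n a"
proof -
  define R where "R = (\<lambda>x. (x - sigma n x) * (5 * x + sigma n x) / (4 * sigma n x ^ 4))"
  define f where "f = (\<lambda>x. hermite_logderiv n x - lambda n x)"
  have "f a \<ge> 0"
  proof (rule minimum_principle_at_top[where f = f and a = a and b = a])
    show "(f \<longlongrightarrow> 0) at_top"
      unfolding f_def using tendsto_diff[OF hermite_logderiv_tendsto[of n] lambda_tendsto[of n]] assms
      by simp
  next
    fix x assume "a \<le> x"
    note x = outer_region_mono[OF assms(2,3) this]
    have "(f has_real_derivative (2 * x * hermite_logderiv n x - 2 * real n - (hermite_logderiv n x)\<^sup>2)
        - (2 * x * lambda n x - 2 * real n - (lambda n x)\<^sup>2 + R x)) (at x)"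
      unfolding f_def R_def by (intro DERIV_diff hermite_logderiv_riccati lambda_riccati x)
    then show "(f has_real_derivative (2 * x - hermite_logderiv n x - lambda n x) * f x - R x) (at x)"
      by (rule DERIV_cong) (simp add: f_def algebra_simps power2_eq_square)
    assume neg: "f x < 0"
    have s: "sigma n x > 0" "sigma n x \<le> x"
      using sigma_pos sigma_le x by auto
    have "lambda n x \<le> (x - sigma n x) * 1"
      unfolding lambda_def using s by (intro mult_left_mono) auto
    then have "2 * x - hermite_logderiv n x - lambda n x > 0"
      using hermite_logderiv_le[OF x] s by simp
    moreover have "R x \<ge> 0"
      unfolding R_def using s by simp
    ultimately show "(2 * x - hermite_logderiv n x - lambda n x) * f x - R x < 0"
      using neg mult_pos_neg[of "2 * x - hermite_logderiv n x - lambda n x" "f x"] by linarith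
  qed simp
  then show ?thesis by (simp add: f_def)
qed

text \<open>The condition 2 x^2 <= s^6 is what yields \<open>excess\<close> <= s/2. It persists to
  the right because s and s^2 / x^2 = 1 - 2 n / x^2 both increase; the proof uses this with
  denominators cleared.\<close>

lemma control_mono:
  fixes a x :: real
  assumes "a > 0" "2 * real n < a\<^sup>2" "a \<le> x" "2 * a\<^sup>2 \<le> sigma n a ^ 6"
  shows "2 * x\<^sup>2 \<le> sigma n x ^ 6"
proof -
  note x = outer_region_mono[OF assms(1-3)]
  have s: "sigma n a > 0" "sigma n x > 0" using sigma_pos assms x by auto
  have sq: "(sigma n a)\<^sup>2 = a\<^sup>2 - 2 * real n" "(sigma n x)\<^sup>2 = x\<^sup>2 - 2 * real n"
    using sigma_square assms x by auto
  have le: "a\<^sup>2 \<le> x\<^sup>2" using assms by (intro power_mono) auto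
  have "(sigma n a)\<^sup>2 * x\<^sup>2 \<le> (sigma n x)\<^sup>2 * a\<^sup>2"
  proof -
    have "real n * a\<^sup>2 \<le> real n * x\<^sup>2" using le by (intro mult_left_mono) auto
    then show ?thesis unfolding sq by (simp add: algebra_simps)
  qed
  then have "2 * ((sigma n a)\<^sup>2 * x\<^sup>2) \<le> (sigma n x)\<^sup>2 * (2 * a\<^sup>2)" by simp
  also have "\<dots> \<le> (sigma n x)\<^sup>2 * sigma n a ^ 6"
    using assms by (intro mult_left_mono) auto
  also have "\<dots> = (sigma n a)\<^sup>2 * ((sigma n x)\<^sup>2 * ((sigma n a)\<^sup>2)\<^sup>2)"
    by (simp add: eval_nat_numeral)
  finally have "2 * x\<^sup>2 \<le> (sigma n x)\<^sup>2 * ((sigma n a)\<^sup>2)\<^sup>2"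
    using s by simp
  also have "\<dots> \<le> (sigma n x)\<^sup>2 * ((sigma n x)\<^sup>2)\<^sup>2"
  proof -
    have "(sigma n a)\<^sup>2 \<le> (sigma n x)\<^sup>2" using sq le by simp
    then show ?thesis by (intro mult_left_mono power_mono[of "(sigma n a)\<^sup>2"]) auto
  qed
  finally show ?thesis by (simp add: eval_nat_numeral)
qed

lemma hermite_logderiv_le_lambda_plus_excess:
  assumes "n > 0" "a > 0" "2 * real n < a\<^sup>2" "2 * a\<^sup>2 \<le> sigma n a ^ 6"
  shows "hermite_logderiv n a \<le> lambda n a + excess n a"
proof -
  define R where "R = (\<lambda>x. (x - sigma n x) * (5 * x + sigma n x) / (4 * sigma n x ^ 4))"
  \<comment> \<open>A choice of derivative at each point; only its sign matters below.\<close>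
  define D where "D = (\<lambda>x. SOME D. (excess n has_real_derivative D) (at x) \<and> D \<le> 0)"
  have D: "(excess n has_real_derivative D x) (at x)" "D x \<le> 0" if "x > 0" "2 * real n < x\<^sup>2" for x
    using has_real_derivative_excess[OF that] someI_ex[of "\<lambda>D. (excess n has_real_derivative D) (at x) \<and> D \<le> 0"]
    unfolding D_def by metis+
  define f where "f = (\<lambda>x. lambda n x + excess n x - hermite_logderiv n x)"
  define A where "A = (\<lambda>x. 2 * x - hermite_logderiv n x - (lambda n x + excess n x))"
  \<comment> \<open>The remainder of f' after \<open>A x * f x\<close> is split off as a difference
    of squares.\<close>
  define R' where "R' = (\<lambda>x. D x + R x + 2 * excess n x * (lambda n x - x) + (excess n x)\<^sup>2)"
  have "f a \<ge> 0"
  proof (rule minimum_principle_at_top[where f = f and a = a and b = a])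
    show "(f \<longlongrightarrow> 0) at_top"
      unfolding f_def
      using tendsto_diff[OF tendsto_add[OF lambda_tendsto[of n] excess_tendsto[of n]] hermite_logderiv_tendsto[of n]] assms
      by simp
  next
    fix x assume ax: "a \<le> x"
    note x = outer_region_mono[OF assms(2,3) this]
    have "(f has_real_derivative ((2 * x * lambda n x - 2 * real n - (lambda n x)\<^sup>2 + R x) + D x)
        - (2 * x * hermite_logderiv n x - 2 * real n - (hermite_logderiv n x)\<^sup>2)) (at x)"
      unfolding f_def R_def by (intro DERIV_diff DERIV_add hermite_logderiv_riccati lambda_riccati D x)
    then show "(f has_real_derivative A x * f x + R' x) (at x)"
      by (rule DERIV_cong) (simp add: f_def A_def R'_def algebra_simps power2_eq_square)
    assume neg: "f x < 0"
    define s where "s = sigma n x"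
    have s: "s > 0" "s \<le> x"
      using sigma_pos sigma_le x by (auto simp: s_def)
    have lam: "lambda n x \<le> (x - s) * 1"
      unfolding lambda_def s_def[symmetric] using s by (intro mult_left_mono) auto
    have exc: "0 \<le> excess n x" using s x by (simp add: excess_def s_def)
    have "excess n x \<le> x\<^sup>2 / s ^ 5"
      unfolding excess_def s_def[symmetric] using s x
      by (intro divide_right_mono) (auto simp: power2_eq_square)
    also have "\<dots> \<le> s / 2"
      using control_mono[OF assms(2,3) ax assms(4)] s
      by (simp add: s_def[symmetric] field_simps eval_nat_numeral)
    finally have exc_le: "excess n x \<le> s / 2" .
    have A: "A x > 0"
      unfolding A_def using lam exc_le hermite_logderiv_le[OF x] s by (simp add: s_def[symmetric])
    \<comment> \<open>The next three bounds contribute 3/2, -2 and 1/2 times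
      \<open>s * excess n x\<close> to \<open>R' x\<close>. They cancel exactly, leaving the
      nonpositive \<open>D x\<close>.\<close>
    have "R x \<le> (x - s) * (6 * x) / (4 * s ^ 4)"
      unfolding R_def s_def[symmetric] using s by (intro divide_right_mono mult_left_mono) auto
    also have "\<dots> = 3 / 2 * s * excess n x"
      unfolding excess_def s_def[symmetric] using s by (simp add: field_simps eval_nat_numeral)
    finally have "R x \<le> 3 / 2 * s * excess n x" .
    moreover have "2 * excess n x * (lambda n x - x) \<le> 2 * excess n x * (- s)"
      using lam exc by (intro mult_left_mono) auto
    moreover have "(excess n x)\<^sup>2 \<le> excess n x * (s / 2)"
      unfolding power2_eq_square using exc_le exc by (intro mult_left_mono) auto
    ultimately have "R' x \<le> 0"
      unfolding R'_def using D(2)[OF x] by (simp add: algebra_simps)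
    then show "A x * f x + R' x < 0"
      using mult_pos_neg[OF A neg] by linarith
  qed simp
  then show ?thesis by (simp add: f_def)
qed

text \<open>The logarithm G of the quotient has derivative h - lambda, which lies between 0 and
  \<open>excess\<close>, and G vanishes at infinity. So G increases to 0, which gives the upper
  bound.\<close>

lemma ln_quotient_bounds:
  assumes "n > 0" "a > 0" "2 * real n < a\<^sup>2" "2 * a\<^sup>2 \<le> sigma n a ^ 6"
  shows "ln (Hermite n a) - ln_Lambda2 n a \<le> 0"
    and "- (a / (2 * sigma n a ^ 3)) \<le> ln (Hermite n a) - ln_Lambda2 n a"
proof -
  define G where "G = (\<lambda>x. ln (Hermite n x) - ln_Lambda2 n x)"
  have lim: "(G \<longlongrightarrow> 0) at_top" unfolding G_def by (rule ln_quotient_tendsto[OF assms(1)])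
  have der: "(G has_real_derivative hermite_logderiv n x - lambda n x) (at x)" if "a \<le> x" for x
  proof -
    note x = outer_region_mono[OF assms(2,3) that]
    have pos: "Hermite n x > 0" using Hermite_pos_and_ratio[OF x] by simp
    have "((\<lambda>x. ln (Hermite n x)) has_real_derivative hermite_logderiv n x) (at x)"
      by (rule DERIV_cong[OF DERIV_chain2[where f = ln, OF DERIV_ln[OF pos] has_real_derivative_Hermite]])
         (simp add: hermite_logderiv_def field_simps)
    then show ?thesis
      unfolding G_def by (intro DERIV_diff has_real_derivative_ln_Lambda2 x)
  qed
  have "G a \<le> 0"
  proof (rule nonpos_of_increasing_to_0[OF lim der])
    fix x assume "a \<le> x"
    note x = outer_region_mono[OF assms(2,3) this]
    show "0 \<le> hermite_logderiv n x - lambda n x"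
      using lambda_le_hermite_logderiv[OF assms(1) x] by simp
  qed
  then show "ln (Hermite n a) - ln_Lambda2 n a \<le> 0" by (simp add: G_def)
  \<comment> \<open>Chosen so that -E' = (3 x^2 - s^2) / (2 s^5) >= x^2 / s^5 >=
    \<open>excess\<close>, using s <= x. Hence G + E decreases to 0 and is nonnegative.\<close>
  define E where "E = (\<lambda>x. x / (2 * sigma n x ^ 3))"
  have "- (G a + E a) \<le> 0"
  proof (rule nonpos_of_increasing_to_0[where f = "\<lambda>x. - (G x + E x)" and a = a])
    have "(E \<longlongrightarrow> 0) at_top"
      using assms(1) unfolding E_def sigma_def by real_asymp
    from tendsto_minus[OF tendsto_add[OF lim this]]
    show "((\<lambda>x. - (G x + E x)) \<longlongrightarrow> 0) at_top" by simp
  next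
    fix x assume ax: "a \<le> x"
    note x = outer_region_mono[OF assms(2,3) this]
    define s where "s = sigma n x"
    have s: "s > 0" "s \<le> x"
      using sigma_pos sigma_le x by (auto simp: s_def)
    have "(E has_real_derivative (s\<^sup>2 - 3 * x\<^sup>2) / (2 * s ^ 5)) (at x)"
      unfolding E_def using x s
      by (auto intro!: derivative_eq_intros simp: s_def[symmetric] field_simps eval_nat_numeral)
    from DERIV_minus[OF DERIV_add[OF der[OF ax] this]]
    show "((\<lambda>x. - (G x + E x)) has_real_derivative
        - (hermite_logderiv n x - lambda n x + (sigma n x ^ 2 - 3 * x\<^sup>2) / (2 * sigma n x ^ 5))) (at x)"
      by (simp add: s_def)
    have "hermite_logderiv n x - lambda n x \<le> excess n x"
      using hermite_logderiv_le_lambda_plus_excess[OF assms(1) x control_mono[OF assms(2,3) ax assms(4)]]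
      by simp
    also have "\<dots> \<le> x\<^sup>2 / s ^ 5"
      unfolding excess_def s_def[symmetric] using s x
      by (intro divide_right_mono) (auto simp: power2_eq_square)
    also have "\<dots> = (2 * x\<^sup>2) / (2 * s ^ 5)" by simp
    also have "\<dots> \<le> (3 * x\<^sup>2 - s\<^sup>2) / (2 * s ^ 5)"
      using s power_mono[of s x 2] by (intro divide_right_mono) auto
    finally show "0 \<le> - (hermite_logderiv n x - lambda n x + (sigma n x ^ 2 - 3 * x\<^sup>2) / (2 * sigma n x ^ 5))"
      by (simp add: s_def diff_divide_distrib)
  qed
  then show "- (a / (2 * sigma n a ^ 3)) \<le> ln (Hermite n a) - ln_Lambda2 n a"
    by (simp add: G_def E_def)
qed

section \<open>Asymptotics along moving points, and reflection to the left region\<close>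

lemma Hermite_asymp_right:
  assumes "in_right_region \<xi>"
  shows "(\<lambda>n. Hermite n (\<xi> n)) \<sim>[sequentially] (\<lambda>n. Lambda2 n (\<xi> n))"
proof -
  define d where "d = (\<lambda>n. \<xi> n - sqrt (2 * real n))"
  define E where "E = (\<lambda>n. \<xi> n / sigma n (\<xi> n) ^ 3)"
  have ev: "eventually (\<lambda>n. n > 0 \<and> d n > 0) sequentially"
    using assms eventually_gt_at_top[of 0] unfolding in_right_region_def d_def
    by (auto intro: eventually_conj)
  have pos: "\<xi> n > 0 \<and> 2 * real n < (\<xi> n)\<^sup>2 \<and> sigma n (\<xi> n) > 0" if "n > 0" "d n > 0" for n
  proof -
    have 1: "sqrt (2 * real n) < \<xi> n" using that by (simp add: d_def)
    then have "\<xi> n > 0" using that real_sqrt_ge_0_iff[of "2 * real n"] by linarith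
    moreover have "2 * real n < (\<xi> n)\<^sup>2" using 1 \<open>\<xi> n > 0\<close>
      by (metis abs_of_pos real_sqrt_abs real_sqrt_less_iff)
    ultimately show ?thesis using sigma_pos by simp
  qed
  have "filterlim (\<lambda>n. (real n powr (1 / 6) * d n) ^ 3) at_top sequentially"
    using assms unfolding in_right_region_def d_def by (intro filterlim_pow_at_top) auto
  then have lim: "((\<lambda>n. inverse ((real n powr (1 / 6) * d n) ^ 3)) \<longlongrightarrow> 0) sequentially"
    by (rule tendsto_inverse_0_at_top)
  \<comment> \<open>Squaring leaves only powers of s^2, which factors as the distance d to the
    turning point times x + sqrt (2 n).\<close>
  have "((\<lambda>n. (E n)\<^sup>2) \<longlongrightarrow> 0) sequentially"
  proof (rule tendsto_sandwich[OF _ _ tendsto_const lim])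
    show "eventually (\<lambda>n. (E n)\<^sup>2 \<le> inverse ((real n powr (1 / 6) * d n) ^ 3)) sequentially"
      using ev
    proof eventually_elim
      case (elim n)
      define x s where "x = \<xi> n" and "s = sqrt (2 * real n)"
      have s: "s \<ge> 0" "s\<^sup>2 = 2 * real n" by (auto simp: s_def)
      have x: "x > 0" "2 * real n < x\<^sup>2" "sigma n x > 0" "d n = x - s"
        using pos[of n] elim by (auto simp: x_def s_def d_def)
      have sig: "(sigma n x)\<^sup>2 = d n * (x + s)"
        unfolding x(4) sigma_square[OF x(2)] s(2)[symmetric] by (simp add: algebra_simps power2_eq_square)
      \<comment> \<open>The layer width enters here: the cube of n^(1/6) is sqrt n, which the factor
        x + sqrt (2 n) dominates.\<close>
      have "(real n powr (1 / 6)) ^ 3 = real n powr (1 / 2)"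
        using elim by (simp add: powr_power)
      also have "\<dots> = sqrt (real n)" by (rule powr_half_sqrt) simp
      also have "\<dots> \<le> x + s" using x(1) real_sqrt_le_mono[of "real n" "2 * real n"] by (simp add: s_def del: real_sqrt_le_iff)
      finally have r: "(real n powr (1 / 6)) ^ 3 \<le> x + s" .
      have "(E n)\<^sup>2 = x\<^sup>2 / ((sigma n x)\<^sup>2) ^ 3"
        by (simp add: E_def x_def power_divide flip: power_mult)
      also have "\<dots> = x\<^sup>2 / (d n ^ 3 * (x + s) ^ 3)"
        unfolding sig by (simp add: power_mult_distrib)
      also have "\<dots> \<le> (x + s)\<^sup>2 / (d n ^ 3 * (x + s) ^ 3)"
        using x s elim by (intro divide_right_mono power_mono) auto
      also have "\<dots> = 1 / (d n ^ 3 * (x + s))"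
        using x(1) s(1) by (simp add: power3_eq_cube power2_eq_square)
      also have "\<dots> \<le> 1 / (d n ^ 3 * (real n powr (1 / 6)) ^ 3)"
        using r elim x s by (intro divide_left_mono mult_left_mono mult_pos_pos) auto
      finally show ?case by (simp add: power_mult_distrib field_simps)
    qed
  qed simp
  then have E2: "((\<lambda>n. sqrt ((E n)\<^sup>2)) \<longlongrightarrow> sqrt 0) sequentially"
    by (rule tendsto_real_sqrt)
  then have E: "(E \<longlongrightarrow> 0) sequentially"
    by (simp add: tendsto_rabs_zero_iff)
  define G where "G = (\<lambda>n. ln (Hermite n (\<xi> n)) - ln_Lambda2 n (\<xi> n))"
  \<comment> \<open>The threshold 1/2 means 2 x < s^3, hence 4 x^2 <= s^6, which is more than
    \<open>ln_quotient_bounds\<close> asks for.\<close>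
  have "eventually (\<lambda>n. E n < 1 / 2) sequentially"
    using E by (rule order_tendstoD) simp
  with ev have bounds: "eventually (\<lambda>n. - (E n / 2) \<le> G n \<and> G n \<le> 0) sequentially"
  proof eventually_elim
    case (elim n)
    note p = pos[of n]
    have "\<xi> n * 2 < sigma n (\<xi> n) ^ 3"
      using elim p by (simp add: E_def field_simps)
    then have "(\<xi> n * 2)\<^sup>2 \<le> (sigma n (\<xi> n) ^ 3)\<^sup>2"
      using elim p by (intro power_mono) auto
    then have "4 * (\<xi> n)\<^sup>2 \<le> sigma n (\<xi> n) ^ 6"
      by (simp add: power_mult_distrib flip: power_mult)
    then have "2 * (\<xi> n)\<^sup>2 \<le> sigma n (\<xi> n) ^ 6"
      using zero_le_power2[of "\<xi> n"] by linarith
    from ln_quotient_bounds[OF _ _ _ this] elim p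
    show ?case by (simp add: G_def E_def)
  qed
  have "(G \<longlongrightarrow> 0) sequentially"
  proof (rule tendsto_sandwich)
    show "((\<lambda>n. - (E n / 2)) \<longlongrightarrow> 0) sequentially"
      using tendsto_minus[OF tendsto_divide[OF E tendsto_const[of 2]]] by simp
  qed (use bounds in \<open>auto elim: eventually_mono\<close>)
  then have "((\<lambda>n. exp (G n)) \<longlongrightarrow> exp 0) sequentially"
    by (rule tendsto_exp)
  then have lim1: "((\<lambda>n. exp (G n)) \<longlongrightarrow> 1) sequentially" by simp
  have "eventually (\<lambda>n. exp (G n) = Hermite n (\<xi> n) / Lambda2 n (\<xi> n)) sequentially"
    using ev
  proof eventually_elim
    case (elim n)
    then show ?case
      using pos[of n] Hermite_pos_and_ratio[of "\<xi> n" n]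
      by (simp add: G_def exp_diff Lambda2_eq_exp)
  qed
  from Lim_transform_eventually[OF lim1 this] show ?thesis
    by (rule asymp_equivI')
qed

text \<open>\<open>sigma\<close> is even in its real argument, so reflection exchanges
  \<open>Phi1\<close> with \<open>Phi2\<close> and \<open>U1\<close> with \<open>U2\<close>.\<close>

lemma Lambda1_minus: "Lambda1 n (- \<xi>) = (-1) ^ n * Lambda2 n \<xi>"
  by (simp add: Lambda1_def Lambda2_def Phi1_def Phi2_def U1_def U2_def sigma_def)

lemma in_right_region_minus: "in_left_region \<xi> \<Longrightarrow> in_right_region (\<lambda>n. - \<xi> n)"
  by (auto simp: in_left_region_def in_right_region_def minus_diff_commute elim: eventually_mono)

theorem mainTheorem1:
  shows "(\<forall>\<xi>. in_left_region \<xi> \<longrightarrow>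
            (\<lambda>n. Hermite n (\<xi> n)) \<sim>[sequentially] (\<lambda>n. Lambda1 n (\<xi> n))) \<and>
         (\<forall>\<xi>. in_right_region \<xi> \<longrightarrow>
            (\<lambda>n. Hermite n (\<xi> n)) \<sim>[sequentially] (\<lambda>n. Lambda2 n (\<xi> n))) \<and>
         (\<forall>(n::nat) (\<xi>::real). \<xi> > sqrt (2 * real n) \<longrightarrow>
            Lambda1 n (- \<xi>) = (-1) ^ n * Lambda2 n \<xi>)"
proof (intro conjI allI impI)
  fix \<xi> assume "in_left_region \<xi>"
  then have "(\<lambda>n. Hermite n (- \<xi> n)) \<sim>[sequentially] (\<lambda>n. Lambda2 n (- \<xi> n))"
    by (intro Hermite_asymp_right in_right_region_minus)
  \<comment> \<open>The sign undoes the reflection on both sides: by parity for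
    \<open>Hermite\<close>, by \<open>Lambda1_minus\<close> for the approximation.\<close>
  then have "(\<lambda>n. (-1) ^ n * Hermite n (- \<xi> n)) \<sim>[sequentially] (\<lambda>n. (-1) ^ n * Lambda2 n (- \<xi> n))"
    by (intro asymp_equiv_mult) auto
  then show "(\<lambda>n. Hermite n (\<xi> n)) \<sim>[sequentially] (\<lambda>n. Lambda1 n (\<xi> n))"
    by (simp flip: Hermite_minus Lambda1_minus)
qed (auto intro: Hermite_asymp_right Lambda1_minus)

end
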